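(* Let $m,n$ be coprime positive integers and let $\mathbf{p}$ be an $(m,n)$-parking function with (unique) fixed point $\mathbf{x}_p\in V^m$. Then $\mathbf{x}_p$ is the centroid of an alcove $A_p$ of the hyperplane arrangement $\mathcal{H}=\{x_i-x_j=km: 0\le i<j\le m-1,\ k\in\mathbb{Z}\}$. The set of periodic points of $\mathbf{p}$ is exactly $A_p\setminus\{\mathbf{x}_p\}$, and all points of $A_p\setminus\{\mathbf{x}_p\}$ have period $m$.
   Context: $[m]=\{0,\dots,m-1\}$ and $V^m=\{\mathbf{x}=(x_0,\dots,x_{m-1})\in\mathbb{R}^m:\sum_i x_i=0,\ x_0\le x_1\le\dots\le x_{m-1}\}$. A letter $i\in[m]$ acts on $\mathbf{x}\in V^m$ by adding $m$ to $x_i$, subtracting $1$ from every coordinate, and then sorting the coordinates increasingly. A word $\mathbf{w}=w_{n-1}\dots w_0\in[m]^n$ acts from right to left, $\mathbf{w}\cdot\mathbf{x}=w_{n-1}\cdot(\cdots(w_0\cdot\mathbf{x}))$. An $(m,n)$-parking function is $\mathbf{w}\in[m]^n$ with $\#\{j:w_j<i\}\ge in/m$ for $1\le i\le m$; for coprime $m,n$ each such word has a unique fixed point in $V^m$. Alcoves are closures of connected components of the complement of $\mathcal{H}$ in $\{\mathbf{x}\in\mathbb{R}^m:\sum x_i=0\}$. The centroid of an alcove $A$ is the unique point $\mathbf{x}$ in the interior of $A$ such that $\frac{m+1}{2}-x_i\in\mathbb{Z}$ for all $i$. A point $\mathbf{x}$ is periodic for $\mathbf{p}$ if $\mathbf{p}^k\cdot\mathbf{x}=\mathbf{x}$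 for some $k\ge1$, where $\mathbf{p}^k$ is $\mathbf{p}$ concatenated with itself $k$ times.
   Formalization: The fixed point x_p is itself periodic (k=1), so the claim is proved as: the periodic points other than x_p are exactly A_p minus x_p. "Period m" means p^m·x = x, not necessarily minimal; minimality fails for composite m. *)

theory Defs
  imports "HOL-Analysis.Analysis"
begin

text \<open>
  A point of $R^m$ is a function of type \<^typ>\<open>nat \<Rightarrow> real\<close> that vanishes outside the
  index set $\{0,\dots,m-1\}$. On such functions the product topology of
  \<^typ>\<open>nat \<Rightarrow> real\<close> restricts to the usual topology of $R^m$.
\<close>

definition zero_sum :: "nat \<Rightarrow> (nat \<Rightarrow> real) set" where
  "zero_sum m = {x. (\<forall>i\<ge>m. x i = 0) \<and> (\<Sum>i<m. x i) = 0}"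

definition sorted_cone :: "nat \<Rightarrow> (nat \<Rightarrow> real) set" where
  "sorted_cone m = {x \<in> zero_sum m. \<forall>i j. i \<le> j \<and> j < m \<longrightarrow> x i \<le> x j}"

definition sort_coords :: "nat \<Rightarrow> (nat \<Rightarrow> real) \<Rightarrow> (nat \<Rightarrow> real)" where
  "sort_coords m y = (\<lambda>j. if j < m then sort (map y [0..<m]) ! j else 0)"

definition letter_act :: "nat \<Rightarrow> nat \<Rightarrow> (nat \<Rightarrow> real) \<Rightarrow> (nat \<Rightarrow> real)" where
  "letter_act m i x = sort_coords m (\<lambda>j. (if j = i then x j + real m else x j) - 1)"

text \<open>
  The word $w_{n-1} \dots w_0$ is the list \<open>w\<close> with \<open>w ! j\<close> equal to $w_j$, that is, in the
  order in which the letters act (the written word read from right to left).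
\<close>

definition word_act :: "nat \<Rightarrow> nat list \<Rightarrow> (nat \<Rightarrow> real) \<Rightarrow> (nat \<Rightarrow> real)" where
  "word_act m w x = fold (letter_act m) w x"

definition word_power :: "nat list \<Rightarrow> nat \<Rightarrow> nat list" where
  "word_power w k = concat (replicate k w)"

definition parking_function :: "nat \<Rightarrow> nat \<Rightarrow> nat list \<Rightarrow> bool" where
  "parking_function m n w \<longleftrightarrow>
     length w = n \<and> set w \<subseteq> {..<m} \<and>
     (\<forall>i\<in>{1..m}. real (card {j. j < n \<and> w ! j < i}) \<ge> real i * real n / real m)"

text \<open>A period need not be minimal.\<close>

definition has_period :: "nat \<Rightarrow> nat list \<Rightarrow> nat \<Rightarrow> (nat \<Rightarrow> real) \<Rightarrow> bool" where
  "has_period m w k x \<longleftrightarrow> k \<ge> 1 \<and> word_act m (word_power w k) x = x"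

definition periodic_points :: "nat \<Rightarrow> nat list \<Rightarrow> (nat \<Rightarrow> real) set" where
  "periodic_points m w = {x \<in> sorted_cone m. \<exists>k. has_period m w k x}"

definition arrangement :: "nat \<Rightarrow> (nat \<Rightarrow> real) set set" where
  "arrangement m =
     {{x. (\<forall>l\<ge>m. x l = 0) \<and> x i - x j = of_int k * real m} | i j (k::int). i < j \<and> j < m}"

definition alcoves :: "nat \<Rightarrow> (nat \<Rightarrow> real) set set" where
  "alcoves m = closure ` components (zero_sum m - \<Union>(arrangement m))"

text \<open>The interior of an alcove is taken in the hyperplane of coordinate sum zero.\<close>

definition is_centroid :: "nat \<Rightarrow> (nat \<Rightarrow> real) set \<Rightarrow> (nat \<Rightarrow> real) \<Rightarrow> bool" where
  "is_centroid m A c \<longleftrightarrow>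
     (let C = {x \<in> top_of_set (zero_sum m) interior_of A.
                 \<forall>i<m. (real m + 1) / 2 - x i \<in> \<int>}
      in c \<in> C \<and> (\<forall>x\<in>C. x = c))"

end

theory Submission
  imports Defs
begin

text \<open>
  Modulo \<open>m\<close>, a letter merely rotates the multiset of coordinates by \<open>1\<close>. For a fixed point this
  multiset is therefore invariant under rotation by \<open>n\<close>, hence, by coprimality, it is a
  full orbit of the rotation by \<open>1\<close>. So the coordinates of a fixed point have distinct residues,
  and the fixed point is the centroid of its alcove.

  On the closed alcove of the fixed point every sorting step can be carried out by the
  permutation used for the fixed point itself; after \<open>m\<close> rounds of the word each coordinate has
  been increased \<open>n\<close> times, so the point has returned. Conversely, letters do not increase the
  Euclidean distance, so the distance between the orbits of a periodic point and of the fixed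
  point is constant. The equality case of the rearrangement inequality then shows that both
  orbits are always similarly ordered. As the coordinates of the fixed point overtake each
  other, these comparisons place the periodic point in the closed alcove.
\<close>

subsection \<open>Sorting and similarly ordered vectors\<close>

text \<open>Symmetric in \<open>u\<close> and \<open>v\<close> by contraposition. Ties are left
  free, so this is exactly the condition under which one permutation sorts both vectors.\<close>

definition co_ordered :: "nat \<Rightarrow> (nat \<Rightarrow> real) \<Rightarrow> (nat \<Rightarrow> real) \<Rightarrow> bool" where
  "co_ordered m u v \<longleftrightarrow> (\<forall>i<m. \<forall>j<m. u i < u j \<longrightarrow> v i \<le> v j)"

text \<open>\<open>\<pi> j\<close> is the old index of the entry that moves to position
  \<open>j\<close>; ties allow several choices.\<close>

definition sorting_perm :: "nat \<Rightarrow> (nat \<Rightarrow> real) \<Rightarrow> (nat \<Rightarrow> nat) \<Rightarrow> bool" where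
  "sorting_perm m u \<pi> \<longleftrightarrow> \<pi> permutes {..<m} \<and> (\<forall>i j. i \<le> j \<and> j < m \<longrightarrow> u (\<pi> i) \<le> u (\<pi> j))"

lemma sort_coords_eq:
  assumes "sorting_perm m u \<pi>"
  shows "sort_coords m u = (\<lambda>j. if j < m then u (\<pi> j) else 0)"
proof -
  have p: "\<pi> permutes {..<m}" using assms by (simp add: sorting_perm_def)
  have lt: "\<pi> i < m" if "i < m" for i
    using permutes_in_image[OF p, of i] that by simp
  have eq: "permute_list \<pi> (map u [0..<m]) = map (\<lambda>j. u (\<pi> j)) [0..<m]"
    by (rule nth_equalityI) (use p lt in \<open>auto simp: permute_list_nth\<close>)
  have "mset (map (\<lambda>j. u (\<pi> j)) [0..<m]) = mset (map u [0..<m])"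
    using mset_permute_list[of \<pi> "map u [0..<m]"] p eq by simp
  moreover have "sorted (map (\<lambda>j. u (\<pi> j)) [0..<m])"
    using assms by (auto simp: sorted_iff_nth_mono sorting_perm_def)
  ultimately have "sort (map u [0..<m]) = map (\<lambda>j. u (\<pi> j)) [0..<m]"
    by (rule properties_for_sort)
  then show ?thesis by (auto simp: sort_coords_def)
qed

lemma sorting_perm_exists: "\<exists>\<pi>. sorting_perm m u \<pi>"
proof -
  let ?ys = "map u [0..<m]"
  obtain \<pi> where p: "\<pi> permutes {..<m}" and e: "permute_list \<pi> ?ys = sort ?ys"
    using mset_eq_permutation[of "sort ?ys" ?ys] by auto
  have lt: "\<pi> i < m" if "i < m" for i
    using permutes_in_image[OF p, of i] that by simp
  have nth: "sort ?ys ! i = u (\<pi> i)" if "i < m" for i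
    using that p lt e[symmetric] by (simp add: permute_list_nth)
  have "u (\<pi> i) \<le> u (\<pi> j)" if "i \<le> j" "j < m" for i j
    using sorted_nth_mono[of "sort ?ys" i j] nth that by simp
  then show ?thesis using p unfolding sorting_perm_def by blast
qed

text \<open>It suffices to sort \<open>u + v\<close>.\<close>

lemma co_ordered_sorting_perm:
  assumes "co_ordered m u v"
  shows "\<exists>\<pi>. sorting_perm m u \<pi> \<and> sorting_perm m v \<pi>"
proof -
  obtain \<pi> where s: "sorting_perm m (\<lambda>i. u i + v i) \<pi>" using sorting_perm_exists by blast
  then have p: "\<pi> permutes {..<m}" by (simp add: sorting_perm_def)
  have "u (\<pi> i) \<le> u (\<pi> j) \<and> v (\<pi> i) \<le> v (\<pi> j)" if "i \<le> j" "j < m" for i j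
  proof -
    have lt: "\<pi> i < m" "\<pi> j < m"
      using permutes_in_image[OF p] that by (metis lessThan_iff order_le_less_trans)+
    have "u (\<pi> i) + v (\<pi> i) \<le> u (\<pi> j) + v (\<pi> j)"
      using s that by (simp add: sorting_perm_def)
    moreover have "u (\<pi> j) < u (\<pi> i) \<Longrightarrow> v (\<pi> j) \<le> v (\<pi> i)"
      "u (\<pi> i) < u (\<pi> j) \<Longrightarrow> v (\<pi> i) \<le> v (\<pi> j)"
      using assms lt by (auto simp: co_ordered_def)
    ultimately show ?thesis by linarith
  qed
  then show ?thesis using p unfolding sorting_perm_def by blast
qed

text \<open>The swap changes the sum by \<open>(u j - u i) * (v i - v j)\<close>, a product of two
  positive factors.\<close>

lemma sum_swap_less:
  fixes u v :: "nat \<Rightarrow> real"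
  assumes "i < m" "j < m" "u i < u j" "v j < v i"
  shows "(\<Sum>k<m. u k * v k) < (\<Sum>k<m. u (Transposition.transpose i j k) * v k)"
proof -
  have ij: "i \<noteq> j" using assms by auto
  have split: "(\<Sum>k<m. f k) = f i + f j + sum f ({..<m} - {i, j})" for f :: "nat \<Rightarrow> real"
    using assms ij by (subst sum.subset_diff[of "{i, j}"]) auto
  have rest: "(\<Sum>k\<in>{..<m} - {i, j}. u (Transposition.transpose i j k) * v k) = (\<Sum>k\<in>{..<m} - {i, j}. u k * v k)"
    by (rule sum.cong) (auto simp: Transposition.transpose_def)
  have "0 < (u j - u i) * (v i - v j)" using assms by simp
  then show ?thesis
    unfolding split[of "\<lambda>k. u k * v k"] split[of "\<lambda>k. u (Transposition.transpose i j k) * v k"] rest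
    by (simp add: algebra_simps)
qed

lemma sum_sort_coords:
  fixes u :: "nat \<Rightarrow> real" and f :: "real \<Rightarrow> real"
  shows "(\<Sum>j<m. f (sort_coords m u j)) = (\<Sum>j<m. f (u j))"
proof -
  obtain \<pi> where s: "sorting_perm m u \<pi>" using sorting_perm_exists by blast
  then have "\<pi> permutes {..<m}" by (simp add: sorting_perm_def)
  then show ?thesis
    unfolding sort_coords_eq[OF s] using sum.permute[of \<pi> "{..<m}" "\<lambda>j. f (u j)"] by (simp add: o_def)
qed

text \<open>A permutation maximizing the scalar product makes the two vectors similarly ordered, as
  otherwise a transposition would increase the product.\<close>

lemma rearrangement:
  shows "(\<Sum>j<m. u j * v j) \<le> (\<Sum>j<m. sort_coords m u j * sort_coords m v j)" (is "?L \<le> ?R")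
    and "(\<Sum>j<m. u j * v j) = (\<Sum>j<m. sort_coords m u j * sort_coords m v j) \<Longrightarrow> co_ordered m u v"
proof -
  define F where "F \<sigma> = (\<Sum>j<m. u (\<sigma> j) * v j)" for \<sigma> :: "nat \<Rightarrow> nat"
  let ?P = "{\<sigma>. \<sigma> permutes {..<m}}"
  have fin: "finite (F ` ?P)" by (simp add: finite_permutations)
  have ne: "F ` ?P \<noteq> {}" using permutes_id by blast
  obtain \<sigma> where \<sigma>: "\<sigma> permutes {..<m}" and M: "F \<sigma> = Max (F ` ?P)"
    using Max_in[OF fin ne] by auto
  have max: "F \<tau> \<le> F \<sigma>" if "\<tau> permutes {..<m}" for \<tau>
    unfolding M using that by (intro Max_ge[OF fin]) auto
  have co: "co_ordered m (\<lambda>j. u (\<tau> j)) v" if t: "\<tau> permutes {..<m}" and e: "F \<tau> = F \<sigma>" for \<tau>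
    unfolding co_ordered_def
  proof (intro allI impI, rule ccontr)
    fix i j assume ij: "i < m" "j < m" and "u (\<tau> i) < u (\<tau> j)" "\<not> v i \<le> v j"
    then have "F \<tau> < F (\<tau> \<circ> Transposition.transpose i j)"
      unfolding F_def using sum_swap_less[of i m j "\<lambda>j. u (\<tau> j)" v] by simp
    moreover have "\<tau> \<circ> Transposition.transpose i j permutes {..<m}"
      using ij t by (intro permutes_compose permutes_swap_id) auto
    ultimately show False using max e by fastforce
  qed
  \<comment> \<open>One permutation sorts both \<open>u\<close> after \<open>\<sigma>\<close> and
    \<open>v\<close>, so reindexing identifies the maximum \<open>F \<sigma>\<close> with the scalar
    product of the sorted vectors, while \<open>F id\<close> is that of the given ones.\<close>
  obtain \<rho> where r: "sorting_perm m (\<lambda>j. u (\<sigma> j)) \<rho>" "sorting_perm m v \<rho>"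
    using co_ordered_sorting_perm[OF co[OF \<sigma> refl]] by blast
  then have pr: "\<rho> permutes {..<m}" by (simp add: sorting_perm_def)
  have "sorting_perm m u (\<sigma> \<circ> \<rho>)"
    using r(1) permutes_compose[OF pr \<sigma>] by (simp add: sorting_perm_def)
  then have "?R = (\<Sum>j<m. u (\<sigma> (\<rho> j)) * v (\<rho> j))"
    using sort_coords_eq r(2) by simp
  also have "\<dots> = F \<sigma>"
    unfolding F_def using sum.permute[OF pr, of "\<lambda>j. u (\<sigma> j) * v j"] by (simp add: o_def)
  finally have R: "?R = F \<sigma>" .
  have L: "?L = F id" by (simp add: F_def)
  show "?L \<le> ?R" unfolding R L by (rule max) (rule permutes_id)
  show "co_ordered m u v" if "?L = ?R"
    using co[of id] that unfolding R L by (simp add: permutes_id)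
qed

section \<open>Euclidean distance under sorting\<close>

definition sq_dist :: "nat \<Rightarrow> (nat \<Rightarrow> real) \<Rightarrow> (nat \<Rightarrow> real) \<Rightarrow> real" where
  "sq_dist m u v = (\<Sum>j<m. (u j - v j)\<^sup>2)"

lemma sq_dist_expand:
  "sq_dist m u v = (\<Sum>j<m. (u j)\<^sup>2) + (\<Sum>j<m. (v j)\<^sup>2) - 2 * (\<Sum>j<m. u j * v j)"
  by (simp add: sq_dist_def power2_diff sum.distrib sum_subtractf sum_distrib_left mult.assoc)

text \<open>Sorting preserves both norms, so only the scalar product matters, and there the
  rearrangement inequality and its equality case apply.\<close>

lemma sq_dist_sort_coords:
  shows "sq_dist m (sort_coords m u) (sort_coords m v) \<le> sq_dist m u v"
    and "sq_dist m (sort_coords m u) (sort_coords m v) = sq_dist m u v \<Longrightarrow> co_ordered m u v"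
  using rearrangement[of u v m] by (simp_all add: sq_dist_expand sum_sort_coords[of "\<lambda>x. x\<^sup>2"])

subsection \<open>Orbits\<close>

definition bump :: "nat \<Rightarrow> nat \<Rightarrow> (nat \<Rightarrow> real) \<Rightarrow> (nat \<Rightarrow> real)" where
  "bump m i x = (\<lambda>j. (if j = i then x j + real m else x j) - 1)"

lemma letter_act_bump: "letter_act m i x = sort_coords m (bump m i x)"
  by (simp add: letter_act_def bump_def)

lemma sq_dist_bump: "sq_dist m (bump m i x) (bump m i y) = sq_dist m x y"
  unfolding sq_dist_def bump_def by (rule sum.cong) auto

text \<open>With an infinite sequence of letters, a word and all its powers become one orbit read at
  different times.\<close>

primrec orb :: "nat \<Rightarrow> (nat \<Rightarrow> nat) \<Rightarrow> (nat \<Rightarrow> real) \<Rightarrow> nat \<Rightarrow> (nat \<Rightarrow> real)" where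
  "orb m w x 0 = x"
| "orb m w x (Suc t) = letter_act m (w t) (orb m w x t)"

lemma orb_add: "orb m w x (s + t) = orb m (\<lambda>r. w (s + r)) (orb m w x s) t"
  by (induction t) auto

lemma orb_fold: "orb m w x t = word_act m (map w [0..<t]) x"
  by (induction t) (auto simp: word_act_def)

lemma word_power_nth:
  "word_power p k = map (\<lambda>t. p ! (t mod length p)) [0..<k * length p]"
proof (induction k)
  case 0
  then show ?case by (simp add: word_power_def)
next
  case (Suc k)
  let ?n = "length p"
  have "word_power p (Suc k) = word_power p k @ p"
    by (simp add: word_power_def replicate_append_same[symmetric] del: replicate.simps)
       (metis append_Nil2 concat.simps concat_append replicate_Suc replicate_append_same)
  also have "\<dots> = map (\<lambda>t. p ! (t mod ?n)) ([0..<k * ?n] @ [k * ?n..<k * ?n + ?n])"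
  proof -
    have "p = map (\<lambda>t. p ! (t mod ?n)) [k * ?n..<k * ?n + ?n]"
      by (rule nth_equalityI) auto
    then show ?thesis using Suc by simp
  qed
  also have "[0..<k * ?n] @ [k * ?n..<k * ?n + ?n] = [0..<Suc k * ?n]"
    using upt_add_eq_append[of 0 "k * ?n" ?n] by (simp add: add.commute)
  finally show ?case .
qed

lemma word_act_power:
  "word_act m (word_power p k) x = orb m (\<lambda>t. p ! (t mod length p)) x (k * length p)"
  by (simp add: orb_fold word_power_nth)

lemma sort_coords_mono: "i \<le> j \<Longrightarrow> j < m \<Longrightarrow> sort_coords m u i \<le> sort_coords m u j"
  unfolding sort_coords_def by (simp add: sorted_nth_mono)

lemma orb_mono:
  assumes "x \<in> sorted_cone m" "i \<le> j" "j < m"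
  shows "orb m w x t i \<le> orb m w x t j"
  using assms by (cases t) (auto simp: sorted_cone_def letter_act_bump sort_coords_mono)

lemma orb_outside:
  assumes "x \<in> zero_sum m" "m \<le> j"
  shows "orb m w x t j = 0"
  using assms by (cases t) (auto simp: zero_sum_def letter_act_bump sort_coords_def)

text \<open>Here \<open>\<pi> t j\<close> is the original position of the coordinate that occupies position \<open>j\<close> at
  time \<open>t\<close>, and \<open>a t i\<close> counts how often the coordinate starting at position \<open>i\<close>
  has been increased by \<open>m\<close>.\<close>

definition tracks ::
  "nat \<Rightarrow> (nat \<Rightarrow> nat) \<Rightarrow> (nat \<Rightarrow> nat \<Rightarrow> int) \<Rightarrow> (nat \<Rightarrow> nat \<Rightarrow> nat) \<Rightarrow> (nat \<Rightarrow> real) \<Rightarrow> bool" where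
  "tracks m w a \<pi> x \<longleftrightarrow>
     a 0 = (\<lambda>i. 0) \<and> \<pi> 0 = id \<and>
     (\<forall>t. \<pi> t permutes {..<m} \<and>
          a (Suc t) = (a t)(\<pi> t (w t) := a t (\<pi> t (w t)) + 1) \<and>
          (\<forall>j<m. orb m w x t j = x (\<pi> t j) + real m * of_int (a t (\<pi> t j)) - real t))"

text \<open>As \<open>\<pi>\<close> is injective, raising position \<open>w t\<close> affects only
  the counter of the original coordinate \<open>\<pi> (w t)\<close>.\<close>

lemma bump_tracked:
  assumes "\<pi> permutes {..<m}" "w t < m" "j < m"
    and "\<And>j. j < m \<Longrightarrow> orb m w x t j = x (\<pi> j) + real m * of_int (a (\<pi> j)) - real t"
  shows "bump m (w t) (orb m w x t) j =
    x (\<pi> j) + real m * of_int ((a(\<pi> (w t) := a (\<pi> (w t)) + 1)) (\<pi> j)) - real (Suc t)"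
proof -
  have "\<pi> j = \<pi> (w t) \<longleftrightarrow> j = w t" using permutes_inj[OF assms(1)] by (auto dest: injD)
  then show ?thesis using assms by (auto simp: bump_def algebra_simps)
qed

text \<open>In each step a common sorting permutation exists for both raised vectors; choosing it
  breaks ties alike, so one bookkeeping serves both orbits.\<close>

lemma tracks_exists:
  assumes w: "\<And>t. w t < m"
    and co: "\<And>t. co_ordered m (bump m (w t) (orb m w x t)) (bump m (w t) (orb m w z t))"
  shows "\<exists>a \<pi>. tracks m w a \<pi> x \<and> tracks m w a \<pi> z"
proof -
  \<comment> \<open>Dependent choice controls the first term only through \<open>P 0\<close>, hence
    the clause for \<open>t = 0\<close>; \<open>Q\<close> links consecutive counters.\<close>
  define P where "P t = (\<lambda>(a :: nat \<Rightarrow> int, \<pi>). (t = 0 \<longrightarrow> a = (\<lambda>i. 0) \<and> \<pi> = id) \<and> \<pi> permutes {..<m} \<and>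
     (\<forall>y\<in>{x, z}. \<forall>j<m. orb m w y t j = y (\<pi> j) + real m * of_int (a (\<pi> j)) - real t))" for t
  define Q where "Q t = (\<lambda>(a :: nat \<Rightarrow> int, \<pi>) (a', \<pi>' :: nat \<Rightarrow> nat).
     a' = a(\<pi> (w t) := a (\<pi> (w t)) + 1))" for t
  have "P 0 (\<lambda>i. 0, id)" by (auto simp: P_def permutes_id)
  moreover have "\<exists>s'. P (Suc t) s' \<and> Q t s s'" if "P t s" for t s
  proof -
    obtain a \<pi> where s: "s = (a, \<pi>)" by force
    have p: "\<pi> permutes {..<m}"
      and f: "\<And>y j. y \<in> {x, z} \<Longrightarrow> j < m \<Longrightarrow>
        orb m w y t j = y (\<pi> j) + real m * of_int (a (\<pi> j)) - real t"
      using that unfolding P_def s by blast+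
    obtain \<rho> where r: "sorting_perm m (bump m (w t) (orb m w x t)) \<rho>"
        "sorting_perm m (bump m (w t) (orb m w z t)) \<rho>"
      using co_ordered_sorting_perm[OF co] by blast
    then have pr: "\<rho> permutes {..<m}" by (simp add: sorting_perm_def)
    have lt: "\<rho> i < m" if "i < m" for i
      using permutes_in_image[OF pr, of i] that by simp
    define a' where "a' = a(\<pi> (w t) := a (\<pi> (w t)) + 1)"
    have "orb m w y (Suc t) j = y ((\<pi> \<circ> \<rho>) j) + real m * of_int (a' ((\<pi> \<circ> \<rho>) j)) - real (Suc t)"
      if "y \<in> {x, z}" "j < m" for y j
    proof -
      have "orb m w y (Suc t) j = bump m (w t) (orb m w y t) (\<rho> j)"
        using that r by (auto simp: letter_act_bump sort_coords_eq)
      also have "\<dots> = y (\<pi> (\<rho> j)) + real m * of_int (a' (\<pi> (\<rho> j))) - real (Suc t)"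
        unfolding a'_def by (rule bump_tracked[OF p w lt[OF that(2)] f[OF that(1)]])
      finally show ?thesis by simp
    qed
    then have "P (Suc t) (a', \<pi> \<circ> \<rho>)" unfolding P_def using permutes_compose[OF pr p] by auto
    then show ?thesis unfolding Q_def s a'_def by blast
  qed
  ultimately obtain f where f: "\<And>t. P t (f t)" "\<And>t. Q t (f t) (f (Suc t))"
    using dependent_nat_choice[of P Q] by metis
  have "tracks m w (\<lambda>t. fst (f t)) (\<lambda>t. snd (f t)) y" if "y \<in> {x, z}" for y
    unfolding tracks_def using f that unfolding P_def Q_def by (auto simp: case_prod_beta)
  then show ?thesis by blast
qed

lemma tracks_exists_single:
  assumes "\<And>t. w t < m"
  shows "\<exists>a \<pi>. tracks m w a \<pi> x"
  using tracks_exists[of w m x x] assms by (auto simp: co_ordered_def)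

text \<open>Both orbits are sorted and hold coordinate \<open>i\<close> at the same position. A
  strict comparison in one orbit fixes the order of the two positions, hence the weak comparison in
  the other.\<close>

lemma tracks_mono:
  assumes "tracks m w a \<pi> x" "tracks m w a \<pi> z" "x \<in> sorted_cone m" "z \<in> sorted_cone m"
    and ij: "i < m" "j < m"
    and less: "z i + real m * of_int (a t i) < z j + real m * of_int (a t j)"
  shows "x i + real m * of_int (a t i) \<le> x j + real m * of_int (a t j)"
proof -
  have p: "\<pi> t permutes {..<m}" using assms(1) by (simp add: tracks_def)
  obtain i' j' where i': "i' < m" "\<pi> t i' = i" and j': "j' < m" "\<pi> t j' = j"
    using permutes_image[OF p] ij by (metis imageE lessThan_iff)
  have ez: "orb m w z t i' = z i + real m * of_int (a t i) - t"
       "orb m w z t j' = z j + real m * of_int (a t j) - t"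
   and ex: "orb m w x t i' = x i + real m * of_int (a t i) - t"
       "orb m w x t j' = x j + real m * of_int (a t j) - t"
    using assms(1,2) i' j' unfolding tracks_def by auto
  have "\<not> j' \<le> i'"
    using orb_mono[OF assms(4), of j' i' w t] i' less ez by linarith
  then show ?thesis
    using orb_mono[OF assms(3), of i' j' w t] j' ex by linarith
qed

subsection \<open>Alcoves\<close>

definition generic :: "nat \<Rightarrow> (nat \<Rightarrow> real) \<Rightarrow> bool" where
  "generic m z \<longleftrightarrow> (\<forall>i<m. \<forall>j<m. \<forall>k::int. z i - z j = of_int k * real m \<longrightarrow> i = j)"

text \<open>Upper bounds suffice: swapping \<open>i\<close> with \<open>j\<close> and negating
  \<open>k\<close> gives the lower ones. For generic \<open>z\<close> this is the connected
  component of \<open>z\<close>.\<close>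

definition open_alcove :: "nat \<Rightarrow> (nat \<Rightarrow> real) \<Rightarrow> (nat \<Rightarrow> real) set" where
  "open_alcove m z = {x \<in> zero_sum m. \<forall>i<m. \<forall>j<m. \<forall>k::int.
     z i - z j < of_int k * real m \<longrightarrow> x i - x j < of_int k * real m}"

definition closed_alcove :: "nat \<Rightarrow> (nat \<Rightarrow> real) \<Rightarrow> (nat \<Rightarrow> real) set" where
  "closed_alcove m z = {x \<in> zero_sum m. \<forall>i<m. \<forall>j<m. \<forall>k::int.
     z i - z j < of_int k * real m \<longrightarrow> x i - x j \<le> of_int k * real m}"

lemma open_alcove_subset_closed_alcove: "open_alcove m z \<subseteq> closed_alcove m z"
  unfolding open_alcove_def closed_alcove_def by (auto intro: less_imp_le)

lemma zero_sum_diff_arrangement: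
  "zero_sum m - \<Union>(arrangement m) = {z \<in> zero_sum m. generic m z}"
proof (intro set_eqI iffI)
  fix z assume "z \<in> zero_sum m - \<Union>(arrangement m)"
  then have z: "z \<in> zero_sum m" and n: "z \<notin> \<Union>(arrangement m)" by auto
  have no: "z i - z j \<noteq> of_int k * real m" if "i < j" "j < m" for i j k
  proof
    assume "z i - z j = of_int k * real m"
    then have "z \<in> {x. (\<forall>l\<ge>m. x l = 0) \<and> x i - x j = of_int k * real m}"
      using z by (simp add: zero_sum_def)
    then show False using n that unfolding arrangement_def by blast
  qed
  have "i = j" if "i < m" "j < m" "z i - z j = of_int k * real m" for i j k
  proof -
    have "z j - z i = of_int (- k) * real m" using that(3) by simp
    then show ?thesis using that no[of i j k] no[of j i "- k"] by (meson linorder_neqE_nat)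
  qed
  then show "z \<in> {z \<in> zero_sum m. generic m z}" using z by (auto simp: generic_def)
next
  fix z assume "z \<in> {z \<in> zero_sum m. generic m z}"
  then have z: "z \<in> zero_sum m" and g: "generic m z" by auto
  have "z \<notin> H" if H': "H \<in> arrangement m" for H
  proof -
    obtain i j k where H: "H = {x. (\<forall>l\<ge>m. x l = 0) \<and> x i - x j = of_int k * real m}"
        and ij: "i < j" "j < m"
      using H' unfolding arrangement_def by blast
    have "z i - z j \<noteq> of_int k * real m"
      using g ij unfolding generic_def by (metis less_irrefl order.strict_trans)
    then show ?thesis unfolding H by simp
  qed
  then show "z \<in> zero_sum m - \<Union>(arrangement m)" using z by blast
qed

lemma open_alcove_generic:
  assumes "generic m z" "x \<in> open_alcove m z"
  shows "generic m x"
  unfolding generic_def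
proof (intro allI impI, rule ccontr)
  fix i j k assume ij: "i < m" "j < m" "i \<noteq> j" and e: "x i - x j = of_int k * real m"
  have lt: "z a - z b < of_int l * real m \<Longrightarrow> x a - x b < of_int l * real m"
    if "a < m" "b < m" for a b l
    using assms(2) that by (auto simp: open_alcove_def)
  have "z i - z j \<noteq> of_int k * real m" using assms(1) ij by (auto simp: generic_def)
  then consider "z i - z j < of_int k * real m" | "z j - z i < of_int (- k) * real m" by force
  then show False
  proof cases
    case 1
    then show ?thesis using lt[of i j k] ij e by simp
  next
    case 2
    then show ?thesis using lt[of j i "- k"] ij e by simp
  qed
qed

lemma self_in_open_alcove: "z \<in> zero_sum m \<Longrightarrow> z \<in> open_alcove m z"
  by (simp add: open_alcove_def)

section \<open>Topology of alcoves: closure, components, interior\<close>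

definition segment :: "(nat \<Rightarrow> real) \<Rightarrow> (nat \<Rightarrow> real) \<Rightarrow> real \<Rightarrow> (nat \<Rightarrow> real)" where
  "segment x z s = (\<lambda>i. (1 - s) * x i + s * z i)"

lemma continuous_on_segment: "continuous_on S (segment x z)"
  unfolding segment_def by (intro continuous_intros)

lemma segment_in_zero_sum:
  assumes "x \<in> zero_sum m" "z \<in> zero_sum m"
  shows "segment x z s \<in> zero_sum m"
  using assms by (auto simp: zero_sum_def segment_def sum.distrib sum_distrib_left[symmetric])

text \<open>A weak and a strict inequality are averaged, with positive weight on the strict
  one.\<close>

lemma segment_in_open_alcove:
  assumes x: "x \<in> closed_alcove m z" and z: "z \<in> zero_sum m" and s: "0 < s" "s \<le> 1"
  shows "segment x z s \<in> open_alcove m z"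
proof -
  have "segment x z s i - segment x z s j < of_int k * real m"
    if "i < m" "j < m" and lt: "z i - z j < of_int k * real m" for i j k
  proof -
    have "x i - x j \<le> of_int k * real m" using x that by (auto simp: closed_alcove_def)
    then have "(1 - s) * (x i - x j) \<le> (1 - s) * (of_int k * real m)"
      using s by (intro mult_left_mono) auto
    moreover have "s * (z i - z j) < s * (of_int k * real m)" using lt s by simp
    ultimately show ?thesis by (simp add: segment_def algebra_simps)
  qed
  then show ?thesis
    using segment_in_zero_sum[of x m z s] x z by (auto simp: open_alcove_def closed_alcove_def)
qed

lemma closed_zero_sum: "closed (zero_sum m)"
proof -
  have "zero_sum m = (\<Inter>i\<in>{m..}. {x. x i = 0}) \<inter> {x. (\<Sum>i<m. x i) = 0}"
    by (auto simp: zero_sum_def)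
  moreover have "closed {x :: nat \<Rightarrow> real. x i = 0}" for i
    by (intro closed_Collect_eq continuous_intros) auto
  moreover have "closed {x :: nat \<Rightarrow> real. (\<Sum>i<m. x i) = 0}"
    by (intro closed_Collect_eq continuous_intros) auto
  ultimately show ?thesis by (auto intro!: closed_INT closed_Int)
qed

lemma closed_closed_alcove: "closed (closed_alcove m z)"
proof -
  have eq: "closed_alcove m z = zero_sum m \<inter>
    (\<Inter>(i, j, k)\<in>{(i, j, k :: int). i < m \<and> j < m \<and> z i - z j < of_int k * real m}.
       {x. x i - x j \<le> of_int k * real m})"
    by (auto simp: closed_alcove_def)
  have "closed {x :: nat \<Rightarrow> real. x i - x j \<le> c}" for i j c
    by (intro closed_Collect_le continuous_intros) auto
  then show ?thesis unfolding eq by (auto intro!: closed_Int closed_zero_sum closed_INT)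
qed

text \<open>A point of the closed alcove is the limit, as \<open>s\<close> tends to 0, of points on
  its segment to \<open>z\<close>, all of them in the open alcove.\<close>

lemma closure_open_alcove:
  assumes z: "z \<in> zero_sum m"
  shows "closure (open_alcove m z) = closed_alcove m z"
proof
  show "closure (open_alcove m z) \<subseteq> closed_alcove m z"
    by (rule closure_minimal[OF open_alcove_subset_closed_alcove closed_closed_alcove])
  show "closed_alcove m z \<subseteq> closure (open_alcove m z)"
  proof
    fix x assume x: "x \<in> closed_alcove m z"
    have "segment x z ` {0<..1} \<subseteq> closure (open_alcove m z)"
      using segment_in_open_alcove[OF x z] closure_subset by fastforce
    then have "segment x z ` closure {0<..1} \<subseteq> closure (open_alcove m z)"
      by (intro image_closure_subset continuous_on_segment) auto
    moreover have "x = segment x z 0" by (simp add: segment_def)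
    ultimately show "x \<in> closure (open_alcove m z)" by auto
  qed
qed

text \<open>The open alcove is star-shaped about \<open>z\<close>. Conversely, a connected set that
  leaves it meets a hyperplane, by the intermediate value theorem for
  \<open>y i - y j\<close>.\<close>

lemma connected_component_open_alcove:
  assumes z: "z \<in> zero_sum m" and g: "generic m z"
  shows "connected_component_set {z \<in> zero_sum m. generic m z} z = open_alcove m z"
proof
  let ?S = "{z \<in> zero_sum m. generic m z}"
  have sub: "open_alcove m z \<subseteq> ?S"
    using open_alcove_generic[OF g] by (auto simp: open_alcove_def)
  show "open_alcove m z \<subseteq> connected_component_set ?S z"
  proof
    fix x assume x: "x \<in> open_alcove m z"
    have "segment x z s \<in> ?S" if "s \<in> {0..1}" for s
    proof (cases "s = 0")
      case True
      then show ?thesis using x sub by (auto simp: segment_def)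
    next
      case False
      then show ?thesis
        using that sub segment_in_open_alcove[of x m z s] x z open_alcove_subset_closed_alcove by auto
    qed
    then have "segment x z ` {0..1} \<subseteq> ?S" by blast
    moreover have "connected (segment x z ` {0..1})"
      by (intro connected_continuous_image continuous_on_segment) auto
    moreover have "segment x z 0 \<in> segment x z ` {0..1}" "segment x z 1 \<in> segment x z ` {0..1}"
      by auto
    moreover have "segment x z 0 = x" "segment x z 1 = z" by (simp_all add: segment_def)
    ultimately show "x \<in> connected_component_set ?S z"
      unfolding connected_component_def by auto
  qed
  show "connected_component_set ?S z \<subseteq> open_alcove m z"
  proof
    fix x assume "x \<in> connected_component_set ?S z"
    then obtain T where T: "connected T" "T \<subseteq> ?S" "z \<in> T" "x \<in> T"
      by (auto simp: connected_component_def)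
    have "x i - x j < of_int k * real m"
      if ij: "i < m" "j < m" and lt: "z i - z j < of_int k * real m" for i j k
    proof (rule ccontr)
      assume n: "\<not> ?thesis"
      have "connected ((\<lambda>y. y i - y j) ` T)"
        by (intro connected_continuous_image T continuous_intros
            continuous_on_subset[OF continuous_on_product_coordinates]) auto
      moreover have "z i - z j \<in> (\<lambda>y. y i - y j) ` T" "x i - x j \<in> (\<lambda>y. y i - y j) ` T"
        using T by auto
      ultimately have "of_int k * real m \<in> (\<lambda>y. y i - y j) ` T"
        using n lt connectedD_interval[of _ "z i - z j" "x i - x j" "of_int k * real m"] by auto
      then obtain y where y: "y \<in> T" "y i - y j = of_int k * real m" by auto
      then have "i = j" using T(2) ij unfolding generic_def by blast
      then show False using n lt by simp
    qed
    then show "x \<in> open_alcove m z" using T by (auto simp: open_alcove_def)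
  qed
qed

lemma closed_alcove_in_alcoves:
  assumes "z \<in> zero_sum m" "generic m z"
  shows "closed_alcove m z \<in> alcoves m"
  unfolding alcoves_def zero_sum_diff_arrangement closure_open_alcove[OF assms(1), symmetric]
    connected_component_open_alcove[OF assms, symmetric]
  by (intro imageI componentsI) (use assms in auto)

text \<open>For each pair of indices the bound with the least \<open>k\<close> implies all others,
  which leaves a finite intersection of open half-spaces.\<close>

lemma openin_open_alcove:
  "openin (top_of_set (zero_sum m)) (open_alcove m z)"
proof (cases "m = 0")
  case True
  then have "open_alcove m z = zero_sum m" by (auto simp: open_alcove_def)
  then show ?thesis by simp
next
  case False
  \<comment> \<open>\<open>c i j\<close> is the least integer strictly above
    \<open>(z i - z j) / m\<close>.\<close>
  define c where "c i j = \<lfloor>(z i - z j) / real m\<rfloor> + 1" for i j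
  have c: "z i - z j < of_int k * real m \<longleftrightarrow> c i j \<le> k" for i j k
  proof -
    have "z i - z j < of_int k * real m \<longleftrightarrow> (z i - z j) / real m < of_int k"
      using False by (simp add: divide_less_eq)
    then show ?thesis unfolding c_def by (simp add: floor_less_iff[symmetric]) linarith
  qed
  have "x \<in> open_alcove m z \<longleftrightarrow>
      x \<in> zero_sum m \<and> (\<forall>i<m. \<forall>j<m. x i - x j < of_int (c i j) * real m)" for x
  proof -
    have "x i - x j < of_int k * real m"
      if "x i - x j < of_int (c i j) * real m" "c i j \<le> k" for i j k
      using that mult_right_mono[of "of_int (c i j)" "of_int k" "real m"] by simp
    then show ?thesis unfolding open_alcove_def c by auto
  qed
  then have "open_alcove m z = zero_sum m \<inter>
      (\<Inter>i\<in>{..<m}. \<Inter>j\<in>{..<m}. {x. x i - x j < of_int (c i j) * real m})" by auto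
  moreover have "open {x :: nat \<Rightarrow> real. x i - x j < b}" for i j b
    by (intro open_Collect_less continuous_intros) auto
  then have "open (\<Inter>i\<in>{..<m}. \<Inter>j\<in>{..<m}. {x. x i - x j < of_int (c i j) * real m})"
    by (intro open_INT) auto
  ultimately show ?thesis by (simp add: openin_open_Int)
qed

lemma interior_closed_alcove:
  "top_of_set (zero_sum m) interior_of closed_alcove m z = open_alcove m z"
proof
  show "open_alcove m z \<subseteq> top_of_set (zero_sum m) interior_of closed_alcove m z"
    by (rule interior_of_maximal[OF open_alcove_subset_closed_alcove openin_open_alcove])
  show "top_of_set (zero_sum m) interior_of closed_alcove m z \<subseteq> open_alcove m z"
  proof
    fix x assume "x \<in> top_of_set (zero_sum m) interior_of closed_alcove m z"
    then obtain U where U: "open U" "x \<in> zero_sum m" "x \<in> U" "zero_sum m \<inter> U \<subseteq> closed_alcove m z"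
      by (auto simp: interior_of_def openin_open)
    have "x i - x j < of_int k * real m"
      if ij: "i < m" "j < m" and lt: "z i - z j < of_int k * real m" for i j k
    proof (cases "i = j")
      case True
      then show ?thesis using lt by simp
    next
      case False
      \<comment> \<open>This line stays in the hyperplane of sum zero and raises
        \<open>x i - x j\<close>. A small step remains in \<open>U\<close> and still obeys the weak
        bound, so the bound at \<open>x\<close> is strict.\<close>
      define \<gamma> where "\<gamma> s = (\<lambda>l. x l + s * (of_bool (l = i) - of_bool (l = j)))" for s :: real
      have cont: "continuous_on UNIV \<gamma>" unfolding \<gamma>_def by (intro continuous_intros)
      have "open (\<gamma> -` U)" using U(1) cont by (simp add: continuous_on_open_vimage)
      moreover have "0 \<in> \<gamma> -` U" using U(3) by (simp add: \<gamma>_def)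
      ultimately obtain e where e: "e > 0" "ball 0 e \<subseteq> \<gamma> -` U" by (meson openE)
      have "e / 2 \<in> ball 0 e" using e by simp
      then have "\<gamma> (e / 2) \<in> U" using e by blast
      moreover have "(\<Sum>l<m. \<gamma> s l) = (\<Sum>l<m. x l)" for s
        using ij by (simp add: \<gamma>_def sum.distrib sum_distrib_left[symmetric] sum_subtractf of_bool_def)
      from this[of "e / 2"] have "\<gamma> (e / 2) \<in> zero_sum m"
        using U(2) ij unfolding zero_sum_def by (auto simp: \<gamma>_def of_bool_def)
      ultimately have "\<gamma> (e / 2) i - \<gamma> (e / 2) j \<le> of_int k * real m"
        using U(4) ij lt by (auto simp: closed_alcove_def)
      then show ?thesis using e(1) False by (simp add: \<gamma>_def)
    qed
    then show "x \<in> open_alcove m z" using U(2) by (simp add: open_alcove_def)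
  qed
qed

text \<open>A point attaining one of the weak bounds would lie on a hyperplane.\<close>

lemma closed_alcove_generic:
  assumes "x \<in> closed_alcove m z" "generic m x" "m > 0"
  shows "x \<in> open_alcove m z"
proof -
  have "x i - x j < of_int k * real m"
    if ij: "i < m" "j < m" and lt: "z i - z j < of_int k * real m" for i j k
  proof -
    have "x i - x j \<le> of_int k * real m" using that assms by (auto simp: closed_alcove_def)
    moreover have "x i - x j \<noteq> of_int k * real m"
      using assms(2) ij lt unfolding generic_def by (metis diff_self less_irrefl)
    ultimately show ?thesis by simp
  qed
  then show ?thesis using assms by (auto simp: open_alcove_def closed_alcove_def)
qed

section \<open>Integral points of an alcove\<close>

lemma residues_surj:
  fixes e :: "nat \<Rightarrow> int"
  assumes inj: "\<And>i j. i < m \<Longrightarrow> j < m \<Longrightarrow> int m dvd e i - e j \<Longrightarrow> i = j" and m: "m > 0"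
  shows "\<exists>l<m. int m dvd d - e l"
proof -
  let ?r = "\<lambda>l. nat (e l mod int m)"
  have "inj_on ?r {..<m}"
  proof (rule inj_onI)
    fix i j assume ij: "i \<in> {..<m}" "j \<in> {..<m}" "?r i = ?r j"
    then have "e i mod int m = e j mod int m" using m by (simp add: eq_nat_nat_iff)
    then show "i = j" using inj ij by (simp add: mod_eq_dvd_iff)
  qed
  moreover have "?r ` {..<m} \<subseteq> {..<m}" using m by (auto simp: nat_less_iff)
  ultimately have "?r ` {..<m} = {..<m}" by (simp add: endo_inj_surj)
  moreover have "nat (d mod int m) \<in> {..<m}" using m by (simp add: nat_less_iff)
  ultimately obtain l where "l < m" "?r l = nat (d mod int m)"
    by (metis (no_types, lifting) imageE lessThan_iff)
  then have "d mod int m = e l mod int m" using m by (simp add: eq_nat_nat_iff)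
  then show ?thesis using \<open>l < m\<close> by (auto simp: mod_eq_dvd_iff)
qed

text \<open>After subtracting \<open>z j\<close>, the translates are integers. Genericity makes each
  occur once, and since the residues of \<open>e\<close> exhaust all classes modulo
  \<open>m\<close>, every integer occurs.\<close>

lemma card_translates_between:
  assumes m: "m > 0" and g: "generic m z" and "i < m" "j < m"
    and int: "\<And>l. l < m \<Longrightarrow> z l - z j = of_int (e l)"
  shows "card {(l, k::int). l < m \<and> z j < z l + of_int k * real m \<and> z l + of_int k * real m \<le> z i}
    = card {0<..e i}"
proof (rule bij_betw_same_card[of "\<lambda>(l, k). e l + k * int m"])
  have zl: "z l = z j + of_int (e l)" if "l < m" for l using int[OF that] by simp
  have inj: "l = l' \<and> k = k'" if "l < m" "l' < m" "e l + k * int m = e l' + k' * int m" for l l' k k'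
  proof -
    have "z l - z l' = of_int (e l - e l')" using zl that by simp
    also have "e l - e l' = (k' - k) * int m" using that by (simp add: algebra_simps)
    finally have "l = l'" using g that unfolding generic_def by (metis of_int_mult of_int_of_nat_eq)
    then show ?thesis using that m by simp
  qed
  have bounds: "z j < z l + of_int k * real m \<longleftrightarrow> 0 < e l + k * int m"
    "z l + of_int k * real m \<le> z i \<longleftrightarrow> e l + k * int m \<le> e i" if "l < m" for l k
  proof -
    have "z l + of_int k * real m = z j + of_int (e l + k * int m)" using zl[OF that] by simp
    then show "z j < z l + of_int k * real m \<longleftrightarrow> 0 < e l + k * int m"
      "z l + of_int k * real m \<le> z i \<longleftrightarrow> e l + k * int m \<le> e i"
      unfolding zl[OF \<open>i < m\<close>] by (simp_all only: add_le_cancel_left of_int_le_iff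
          less_add_same_cancel1 of_int_0_less_iff)
  qed
  have surj: "\<exists>l<m. \<exists>k. d = e l + k * int m" for d
  proof -
    have "\<exists>l<m. int m dvd d - e l"
    proof (rule residues_surj[OF _ m])
      fix a b assume ab: "a < m" "b < m" "int m dvd e a - e b"
      then obtain q where "e a - e b = int m * q" by (auto elim: dvdE)
      then show "a = b" using inj[of a b 0 q] ab by (simp add: algebra_simps)
    qed
    then show ?thesis by (metis add.commute diff_add_cancel dvd_def mult.commute)
  qed
  show "bij_betw (\<lambda>(l, k). e l + k * int m)
    {(l, k). l < m \<and> z j < z l + of_int k * real m \<and> z l + of_int k * real m \<le> z i} {0<..e i}"
    unfolding bij_betw_def
  proof (intro conjI set_eqI iffI)
    fix d assume "d \<in> {0<..e i}"
    moreover obtain l k where "l < m" "d = e l + k * int m" using surj by blast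
    ultimately show "d \<in> (\<lambda>(l, k). e l + k * int m) `
      {(l, k). l < m \<and> z j < z l + of_int k * real m \<and> z l + of_int k * real m \<le> z i}"
      using bounds by (intro image_eqI[of _ _ "(l, k)"]) auto
  qed (use inj bounds in \<open>auto simp: inj_on_def\<close>)
qed

text \<open>Summing the differences over \<open>j\<close> gives \<open>m\<close> times a
  coordinate.\<close>

lemma zero_sum_eqI:
  assumes "x \<in> zero_sum m" "z \<in> zero_sum m"
    and d: "\<And>i j. i < m \<Longrightarrow> j < m \<Longrightarrow> x i - x j = z i - z j"
  shows "x = z"
proof
  fix i
  show "x i = z i"
  proof (cases "i < m")
    case True
    have "(\<Sum>j<m. x i - x j) = (\<Sum>j<m. z i - z j)" using d True by (intro sum.cong) auto
    then have "real m * x i = real m * z i" using assms by (simp add: sum_subtractf zero_sum_def)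
    then show ?thesis using True by simp
  qed (use assms in \<open>auto simp: zero_sum_def\<close>)
qed

text \<open>An alcove determines the order of all numbers \<open>x l + k m\<close>; on integral points these
  numbers form a coset of the integers, so differences are read off by counting.\<close>

lemma integral_point_unique:
  assumes m: "m > 0" and z: "z \<in> zero_sum m" "generic m z" and x: "x \<in> open_alcove m z"
    and iz: "\<And>i j. i < m \<Longrightarrow> j < m \<Longrightarrow> z i - z j \<in> \<int>"
    and ix: "\<And>i j. i < m \<Longrightarrow> j < m \<Longrightarrow> x i - x j \<in> \<int>"
  shows "x = z"
proof (rule zero_sum_eqI)
  show "x \<in> zero_sum m" "z \<in> zero_sum m" using x z by (auto simp: open_alcove_def)
  have gx: "generic m x" by (rule open_alcove_generic[OF z(2) x])
  have lt: "z a - z b < of_int l * real m \<Longrightarrow> x a - x b < of_int l * real m"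
    if "a < m" "b < m" for a b l
    using x that by (auto simp: open_alcove_def)
  \<comment> \<open>For the converse, genericity of \<open>z\<close> excludes equality, and the
    opposite strict inequality would transfer to \<open>x\<close> with \<open>- k\<close>.\<close>
  have iff: "z a < z b + of_int k * real m \<longleftrightarrow> x a < x b + of_int k * real m"
    if ab: "a < m" "b < m" for a b k
  proof
    assume "z a < z b + of_int k * real m"
    then show "x a < x b + of_int k * real m" using lt[OF ab, of k] by simp
  next
    assume l: "x a < x b + of_int k * real m"
    show "z a < z b + of_int k * real m"
    proof (rule ccontr)
      assume n: "\<not> ?thesis"
      show False
      proof (cases "z a = z b + of_int k * real m")
        case True
        then have "z a - z b = of_int k * real m" by simp
        then have "a = b" using z(2) ab unfolding generic_def by blast
        then show False using l True by auto
      next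
        case False
        then have "z b - z a < of_int (- k) * real m" using n by simp
        then show False using lt[of b a "- k"] ab l by simp
      qed
    qed
  qed
  have "card {0<..\<lfloor>z i - z j\<rfloor>} = card {0<..\<lfloor>x i - x j\<rfloor>}" if ij: "i < m" "j < m" for i j
  proof -
    have "card {0<..\<lfloor>z i - z j\<rfloor>} = card {(l, k::int). l < m \<and>
        z j < z l + of_int k * real m \<and> z l + of_int k * real m \<le> z i}"
      using ij iz by (intro card_translates_between[symmetric] m z) auto
    also have "{(l, k::int). l < m \<and>
        z j < z l + of_int k * real m \<and> z l + of_int k * real m \<le> z i} =
      {(l, k::int). l < m \<and> x j < x l + of_int k * real m \<and> x l + of_int k * real m \<le> x i}"
    proof -
      have "z l + of_int k * real m \<le> z i \<longleftrightarrow> x l + of_int k * real m \<le> x i" if "l < m" for l k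
        using iff[of l i "- k"] iff[of i l k] that ij by linarith
      then show ?thesis using iff ij by auto
    qed
    also have "card \<dots> = card {0<..\<lfloor>x i - x j\<rfloor>}"
      using ij ix by (intro card_translates_between m gx) auto
    finally show ?thesis .
  qed
  then have nat: "nat \<lfloor>z i - z j\<rfloor> = nat \<lfloor>x i - x j\<rfloor>" if "i < m" "j < m" for i j
    using that by simp
  show "x i - x j = z i - z j" if ij: "i < m" "j < m" for i j
  proof -
    obtain d e where de: "z i - z j = of_int d" "x i - x j = of_int e"
      using iz[OF ij] ix[OF ij] by (auto elim!: Ints_cases)
    \<comment> \<open>\<open>{0<..d}\<close> counts only the positive part of \<open>d\<close>; the
      reversed pair supplies the negative part.\<close>
    then have "z j - z i = of_int (- d)" "x j - x i = of_int (- e)" by simp_all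
    then have "nat d = nat e" "nat (- d) = nat (- e)"
      using nat[OF ij] nat[of j i] ij de by (simp_all only: floor_of_int)
    then show ?thesis using de by simp
  qed
qed

subsection \<open>Fixed and periodic points\<close>

text \<open>The inequalities that sort the orbit of \<open>z\<close> are strict between different
  coordinates, by genericity. They hold weakly on the closed alcove, so the same permutations sort
  the orbit of \<open>x\<close>.\<close>

lemma tracks_closed_alcove:
  assumes tr: "tracks m w a \<pi> z" and g: "generic m z" and z: "z \<in> sorted_cone m"
    and x: "x \<in> closed_alcove m z" and w: "\<And>t. w t < m"
  shows "tracks m w a \<pi> x"
proof -
  have a0: "a 0 = (\<lambda>i. 0)" "\<pi> 0 = id" and p: "\<And>t. \<pi> t permutes {..<m}"
    and aS: "\<And>t. a (Suc t) = (a t)(\<pi> t (w t) := a t (\<pi> t (w t)) + 1)"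
    and oz: "\<And>t j. j < m \<Longrightarrow> orb m w z t j = z (\<pi> t j) + real m * of_int (a t (\<pi> t j)) - real t"
    using tr by (auto simp: tracks_def)
  have lt: "\<pi> t i < m" if "i < m" for t i
    using permutes_in_image[OF p, of t i] that by simp
  have "\<forall>j<m. orb m w x t j = x (\<pi> t j) + real m * of_int (a t (\<pi> t j)) - real t" for t
  proof (induction t)
    case 0
    then show ?case by (simp add: a0)
  next
    case (Suc t)
    let ?y = "bump m (w t) (orb m w x t)"
    \<comment> \<open>The permutation that sorts the orbit of \<open>z\<close> in step
      \<open>t\<close>, recovered from the positions before and after.\<close>
    define \<rho> where "\<rho> = inv (\<pi> t) \<circ> \<pi> (Suc t)"
    have pr: "\<rho> permutes {..<m}"
      unfolding \<rho>_def by (intro permutes_compose permutes_inv p)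
    have \<rho>: "\<pi> t (\<rho> j) = \<pi> (Suc t) j" for j
      unfolding \<rho>_def by (simp add: permutes_inverses[OF p])
    have y: "?y (\<rho> j) = x (\<pi> (Suc t) j) + real m * of_int (a (Suc t) (\<pi> (Suc t) j)) - real (Suc t)"
      if "j < m" for j
      using bump_tracked[of "\<pi> t" m w t "\<rho> j" x "a t"] Suc p w permutes_in_image[OF pr, of j] that
      by (simp add: aS \<rho>)
    have "?y (\<rho> i) \<le> ?y (\<rho> j)" if ij: "i \<le> j" "j < m" for i j
    proof -
      let ?i = "\<pi> (Suc t) i" and ?j = "\<pi> (Suc t) j"
      let ?k = "a (Suc t) ?j - a (Suc t) ?i"
      have im: "i < m" using ij by simp
      have "z ?i - z ?j \<le> of_int ?k * real m"
        using orb_mono[OF z ij, of w "Suc t"] oz[OF im, of "Suc t"] oz[OF ij(2), of "Suc t"]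
        by (simp add: algebra_simps)
      then consider "z ?i - z ?j < of_int ?k * real m" | "z ?i - z ?j = of_int ?k * real m"
        by linarith
      then show ?thesis
      proof cases
        case 1
        then have "x ?i - x ?j \<le> of_int ?k * real m"
          using x lt im ij unfolding closed_alcove_def by blast
        then show ?thesis unfolding y[OF im] y[OF ij(2)] by (simp add: algebra_simps)
      next
        case 2
        then have "?i = ?j" using g lt im ij unfolding generic_def by blast
        then show ?thesis unfolding y[OF im] y[OF ij(2)] by simp
      qed
    qed
    then have "sorting_perm m ?y \<rho>" using pr by (simp add: sorting_perm_def)
    then have "orb m w x (Suc t) = (\<lambda>j. if j < m then ?y (\<rho> j) else 0)"
      by (simp add: letter_act_bump sort_coords_eq)
    then show ?case using y by simp
  qed
  then show ?thesis using a0 p aS by (simp add: tracks_def)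
qed

lemma closed_alcove_subset_sorted_cone:
  assumes "z \<in> sorted_cone m" "generic m z"
  shows "closed_alcove m z \<subseteq> sorted_cone m"
proof
  fix x assume x: "x \<in> closed_alcove m z"
  have "x i \<le> x j" if "i \<le> j" "j < m" for i j
  proof (cases "i = j")
    case False
    have im: "i < m" using that by simp
    \<comment> \<open>The walls with \<open>k = 0\<close> matter here: genericity makes the order of
      the coordinates of \<open>z\<close> strict.\<close>
    have "z i - z j \<noteq> of_int 0 * real m"
      using assms(2) im that False unfolding generic_def by blast
    moreover have "z i \<le> z j" using assms(1) that by (auto simp: sorted_cone_def)
    ultimately have "z i - z j < of_int 0 * real m" by simp
    then have "x i - x j \<le> of_int 0 * real m"
      using x im that unfolding closed_alcove_def by blast
    then show ?thesis by simp
  qed simp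
  then show "x \<in> sorted_cone m" using x by (auto simp: sorted_cone_def closed_alcove_def)
qed

text \<open>The times may come in either order; a descent is handled by negating
  \<open>f\<close>.\<close>

lemma int_intermediate_value:
  fixes f :: "nat \<Rightarrow> int"
  assumes step: "\<And>t. \<bar>f (Suc t) - f t\<bar> \<le> 1" and "f s \<le> k" "k \<le> f t"
  shows "\<exists>r. f r = k"
proof (cases "s \<le> t")
  case True
  then show ?thesis using nat_intermed_int_val[of s t f k] assms by blast
next
  case False
  have "\<bar>- f (Suc t) - - f t\<bar> \<le> 1" for t using step[of t] by linarith
  then have "\<exists>r. - f r = - k"
    using nat_intermed_int_val[of t s "\<lambda>t. - f t" "- k"] False assms by fastforce
  then show ?thesis by simp
qed

section \<open>Letter sequences of period \<open>n\<close>\<close>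

locale periodic_letters =
  fixes m n :: nat and w :: "nat \<Rightarrow> nat"
  assumes m: "m > 0" and n: "n > 0" and coprime: "coprime m n"
    and w: "\<And>t. w t < m" and w_add: "\<And>t. w (t + n) = w t"
begin

lemma w_add_mult: "w (k * n + t) = w t"
proof (induction k)
  case (Suc k)
  then show ?case using w_add[of "k * n + t"] by (simp add: algebra_simps)
qed simp

lemma orb_add_mult: "orb m w x (k * n + t) = orb m w (orb m w x (k * n)) t"
  by (simp add: orb_add w_add_mult)

lemma orb_mult_fixed: "orb m w z n = z \<Longrightarrow> orb m w z (k * n) = z"
proof (induction k)
  case (Suc k)
  then show ?case using orb_add_mult[of z k n] by (simp add: add.commute)
qed simp

text \<open>The distance of two orbits is nonincreasing, hence constant if both orbits are periodic;
  then every sorting step attains equality in the rearrangement inequality.\<close>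

lemma co_ordered_periodic:
  assumes "orb m w x (k * n) = x" "orb m w z n = z" "k \<ge> 1"
  shows "co_ordered m (bump m (w t) (orb m w x t)) (bump m (w t) (orb m w z t))"
proof -
  define f where "f t = sq_dist m (orb m w x t) (orb m w z t)" for t
  have dec: "f (Suc t) \<le> f t" for t
    using sq_dist_sort_coords(1)[of m "bump m (w t) (orb m w x t)" "bump m (w t) (orb m w z t)"]
    by (simp add: f_def letter_act_bump sq_dist_bump)
  have "f (k * n + t) = f t"
    using assms by (simp add: f_def orb_add_mult orb_mult_fixed)
  moreover have "f (k * n + t) \<le> f (Suc t)"
    using assms(3) n by (intro lift_Suc_antimono_le[of f, OF dec]) (simp add: Suc_leI)
  ultimately have "f (Suc t) = f t" using dec[of t] by simp
  then show ?thesis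
    by (intro sq_dist_sort_coords(2)) (simp add: f_def letter_act_bump sq_dist_bump)
qed

end

section \<open>Coordinates of a fixed point over complete rounds\<close>

locale fixed_point_tracks = periodic_letters +
  fixes z :: "nat \<Rightarrow> real" and a :: "nat \<Rightarrow> nat \<Rightarrow> int" and \<pi> :: "nat \<Rightarrow> nat \<Rightarrow> nat"
  assumes z: "z \<in> sorted_cone m" and fixed: "orb m w z n = z" and tr: "tracks m w a \<pi> z"
begin

lemma permutes: "\<pi> t permutes {..<m}"
  using tr by (simp add: tracks_def)

lemma orb_z: "j < m \<Longrightarrow> orb m w z t j = z (\<pi> t j) + real m * of_int (a t (\<pi> t j)) - real t"
  using tr by (simp add: tracks_def)

text \<open>The position held after \<open>s\<close> rounds by the coordinate that started at
  \<open>i\<close>.\<close>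

definition pos :: "nat \<Rightarrow> nat \<Rightarrow> nat" where
  "pos s i = inv (\<pi> (s * n)) i"

lemma pos_less: "i < m \<Longrightarrow> pos s i < m"
  using permutes_in_image[OF permutes_inv[OF permutes], of "s * n" i] by (simp add: pos_def)

lemma pos_0: "pos 0 i = i"
  using tr by (simp add: pos_def tracks_def)

lemma pos_eq_iff: "pos s i = pos s j \<longleftrightarrow> i = j"
  using permutes_inj[OF permutes_inv[OF permutes], of "s * n"] by (auto simp: pos_def dest: injD)

text \<open>After complete rounds the orbit is at \<open>z\<close> again, so the tracked value is
  itself an entry of \<open>z\<close>.\<close>

lemma z_pos:
  assumes "i < m"
  shows "z (pos s i) = z i + real m * of_int (a (s * n) i) - real s * real n"
  using orb_z[OF pos_less[OF assms, of s], of "s * n"] orb_mult_fixed[OF fixed, of s]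
  by (simp add: pos_def permutes_inverses[OF permutes])

text \<open>Coprimality cancels \<open>n\<close> modulo \<open>m\<close>, and both numbers are below
  \<open>m\<close>.\<close>

lemma dvd_mult_n_imp_eq:
  fixes q :: int
  assumes "s < m" "s' < m" "real s * real n - real s' * real n = real m * of_int q"
  shows "s = s'"
proof -
  have "real_of_int ((int s - int s') * int n) = of_int (int m * q)"
    using assms(3) by (simp add: algebra_simps)
  then have "(int s - int s') * int n = int m * q" by (simp only: of_int_eq_iff)
  then have "int m dvd (int s - int s') * int n" by simp
  then have "int m dvd int s - int s'" using coprime by (simp add: coprime_dvd_mult_left_iff)
  then have "int s mod int m = int s' mod int m" by (simp add: mod_eq_dvd_iff)
  then show ?thesis using assms by simp
qed

text \<open>The residue of \<open>z (pos s i)\<close> modulo \<open>m\<close> is that of \<open>z i - s n\<close>, so by coprimality each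
  coordinate visits every position exactly once in \<open>m\<close> rounds.\<close>

lemma bij_betw_pos:
  assumes "i < m"
  shows "bij_betw (\<lambda>s. pos s i) {..<m} {..<m}"
proof -
  have "inj_on (\<lambda>s. pos s i) {..<m}"
  proof (rule inj_onI)
    fix s s' assume s: "s \<in> {..<m}" "s' \<in> {..<m}" and "pos s i = pos s' i"
    then have "real s * real n - real s' * real n = real m * of_int (a (s * n) i - a (s' * n) i)"
      using z_pos[OF assms, of s] z_pos[OF assms, of s'] by (simp add: algebra_simps)
    then show "s = s'" using dvd_mult_n_imp_eq s by blast
  qed
  moreover have "(\<lambda>s. pos s i) ` {..<m} \<subseteq> {..<m}" using pos_less assms by auto
  ultimately show ?thesis unfolding bij_betw_def by (simp add: endo_inj_surj)
qed

lemma pos_surj: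
  assumes "i < m" "j < m"
  obtains s where "s < m" "pos s i = j"
  using bij_betw_imp_surj_on[OF bij_betw_pos[OF assms(1)]] assms(2) by (metis imageE lessThan_iff)

lemma sum_z_pos: "i < m \<Longrightarrow> (\<Sum>s<m. z (pos s i)) = 0"
  using sum.reindex_bij_betw[OF bij_betw_pos, of i z] z by (simp add: sorted_cone_def zero_sum_def)

text \<open>Coordinate \<open>i\<close> reaches position \<open>j\<close> after some
  \<open>s < m\<close> rounds. If \<open>z i\<close> and \<open>z j\<close> agree modulo
  \<open>m\<close>, then \<open>m\<close> divides \<open>s n\<close>, so
  \<open>s = 0\<close>.\<close>

lemma generic: "generic m z"
  unfolding generic_def
proof (intro allI impI)
  fix i j k assume ij: "i < m" "j < m" and e: "z i - z j = of_int k * real m"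
  obtain s where s: "s < m" "pos s i = j" using pos_surj ij by blast
  have "real s * real n - real 0 * real n = real m * of_int (k + a (s * n) i)"
    using z_pos[OF ij(1), of s] s(2) e by (simp add: algebra_simps)
  then have "s = 0" using dvd_mult_n_imp_eq s(1) m by blast
  then show "i = j" using s(2) pos_0 by simp
qed

lemma diff_in_Ints:
  assumes "i < m" "j < m"
  shows "z i - z j \<in> \<int>"
proof -
  obtain s where "pos s i = j" using pos_surj assms by blast
  then have "z i - z j = of_int (int s * int n - int m * a (s * n) i)"
    using z_pos[OF assms(1), of s] by simp
  then show ?thesis by (metis Ints_of_int)
qed

text \<open>Summing \<open>z_pos\<close> over \<open>m\<close> rounds, the entries of
  \<open>z\<close> cancel, which expresses \<open>z i\<close> through the integer
  \<open>A\<close>.\<close>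

lemma centroid_in_Ints:
  assumes i: "i < m"
  shows "(real m + 1) / 2 - z i \<in> \<int>"
proof -
  define A where "A = (\<Sum>s<m. a (s * n) i)"
  have gauss: "(\<Sum>s<m. real s) = real m * (real m - 1) / 2"
    using double_gauss_sum[of "m - 1", where ?'a = real] m
    by (simp add: lessThan_Suc_atMost[symmetric] atLeast0AtMost mult.commute)
  have "0 = (\<Sum>s<m. z i + real m * of_int (a (s * n) i) - real s * real n)"
    using sum_z_pos[OF i] z_pos[OF i] by simp
  also have "\<dots> = real m * (z i + of_int A - (real m - 1) * real n / 2)"
    unfolding A_def
    by (simp add: sum.distrib sum_subtractf sum_distrib_left[symmetric] sum_distrib_right[symmetric]
        gauss algebra_simps)
  finally have zi: "z i = (real m - 1) * real n / 2 - of_int A" using m by simp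
  \<comment> \<open>For odd \<open>m\<close> both terms are even; for even \<open>m\<close>
    coprimality makes \<open>n\<close> odd, so both are odd.\<close>
  have "even (int m + 1 - (int m - 1) * int n)"
    using coprime by (cases "even m") (auto dest: coprime_common_divisor[of m n 2])
  then obtain c where "int m + 1 - (int m - 1) * int n = 2 * c" by (rule evenE)
  then have "real_of_int (int m + 1 - (int m - 1) * int n) = of_int (2 * c)" by (simp only:)
  then have "(real m + 1) / 2 - z i = of_int (c + A)" unfolding zi by (simp add: field_simps)
  then show ?thesis by (metis Ints_of_int)
qed

text \<open>In \<open>m\<close> rounds both coordinates run through all entries of \<open>z\<close>,
  so their values have equal sums and neither can stay ahead throughout.\<close>

lemma overtakes:
  assumes "i < m" "j < m" "i \<noteq> j"
  shows "\<exists>t. z i + real m * of_int (a t i) < z j + real m * of_int (a t j)"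
proof (rule ccontr)
  assume "\<not> ?thesis"
  then have le: "z j + real m * of_int (a t j) \<le> z i + real m * of_int (a t i)" for t
    by (simp add: not_less)
  have "z (pos s j) < z (pos s i)" for s
  proof -
    have "z (pos s i) - z (pos s j) \<noteq> of_int 0 * real m"
      using generic pos_less assms pos_eq_iff unfolding generic_def by blast
    moreover have "z (pos s j) \<le> z (pos s i)" using z_pos assms le[of "s * n"] by simp
    ultimately show ?thesis by simp
  qed
  then have "(\<Sum>s<m. z (pos s j)) < (\<Sum>s<m. z (pos s i))"
    using m by (intro sum_strict_mono) auto
  then show False using sum_z_pos assms by simp
qed

text \<open>After \<open>m\<close> rounds the total decrease \<open>m n\<close> is divisible by
  \<open>m\<close>, so genericity puts every coordinate of \<open>z\<close> back in its place,
  raised \<open>n\<close> times. The point \<open>x\<close> shares this bookkeeping.\<close>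

lemma return:
  assumes "x \<in> closed_alcove m z"
  shows "orb m w x (m * n) = x"
proof
  fix j
  show "orb m w x (m * n) j = x j"
  proof (cases "j < m")
    case True
    let ?i = "\<pi> (m * n) j"
    have "z j = z ?i + real m * of_int (a (m * n) ?i) - real m * real n"
      using orb_z[OF True, of "m * n"] orb_mult_fixed[OF fixed, of m] by simp
    then have e: "z ?i - z j = of_int (int n - a (m * n) ?i) * real m" by (simp add: algebra_simps)
    have "?i < m" using permutes_in_image[OF permutes, of "m * n" j] True by simp
    then have ij: "?i = j" using e generic True unfolding generic_def by blast
    then have "a (m * n) j = int n" using e m by simp
    moreover have "tracks m w a \<pi> x" by (rule tracks_closed_alcove[OF tr generic z assms w])
    ultimately show ?thesis using True ij by (simp add: tracks_def)
  next
    case False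
    then show ?thesis using orb_outside[of x m j w "m * n"] assms
      by (auto simp: closed_alcove_def zero_sum_def)
  qed
qed

text \<open>Any two coordinates of the fixed point overtake each other in both directions, and their
  distance changes in steps of \<open>m\<close>; so both walls bounding their difference are witnessed by
  an order comparison at some time.\<close>

lemma tracked_in_closed_alcove:
  assumes x: "x \<in> sorted_cone m" and trx: "tracks m w a \<pi> x"
  shows "x \<in> closed_alcove m z"
proof -
  have "x i - x j \<le> of_int k * real m"
    if ij: "i < m" "j < m" and lt: "z i - z j < of_int k * real m" for i j k
  proof (cases "i = j")
    case True
    then show ?thesis using lt by simp
  next
    case False
    define f where "f t = a t j - a t i" for t
    have step: "\<bar>f (Suc t) - f t\<bar> \<le> 1" for t
      using tr by (auto simp: tracks_def f_def)
    have le: "x i - x j \<le> of_int (f t) * real m" if "z i - z j < of_int (f t) * real m" for t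
      using tracks_mono[OF trx tr x z ij, of t] that by (simp add: f_def algebra_simps)
    obtain t where t: "z i - z j < of_int (f t) * real m"
      using overtakes[OF ij False] by (auto simp: f_def algebra_simps)
    obtain s where "z j + real m * of_int (a s j) < z i + real m * of_int (a s i)"
      using overtakes[of j i] ij False by auto
    then have "of_int (f s) * real m < z i - z j" by (simp add: f_def algebra_simps)
    then have "of_int (f s) * real m < of_int k * real m" using lt by linarith
    then have s: "f s \<le> k" by (simp add: mult_less_cancel_right)
    \<comment> \<open>A level \<open>f t \<le> k\<close> gives a stronger bound; otherwise
      \<open>f\<close>, moving in unit steps, takes the value \<open>k\<close>, as
      \<open>f s \<le> k\<close>.\<close>
    show ?thesis
    proof (cases "f t \<le> k")
      case True
      then have "of_int (f t) * real m \<le> of_int k * real m" by (intro mult_right_mono) auto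
      then show ?thesis using le[OF t] by linarith
    next
      case False
      then obtain r where "f r = k" using int_intermediate_value[of f, OF step s, of t] by auto
      then show ?thesis using le[of r] lt by simp
    qed
  qed
  then show ?thesis using x by (simp add: closed_alcove_def sorted_cone_def)
qed

end

section \<open>Periodic points compared with a fixed point\<close>

context periodic_letters
begin

lemma fixed_point_tracks_exists:
  assumes "z \<in> sorted_cone m" "orb m w z n = z"
  shows "\<exists>a \<pi>. fixed_point_tracks m n w z a \<pi>"
  using tracks_exists_single[of w m z] w assms
  by (auto simp: fixed_point_tracks_def fixed_point_tracks_axioms_def periodic_letters_axioms)

text \<open>Constancy of the distance makes both orbits similarly ordered at all times, which yields
  common tracks.\<close>

lemma periodic_in_closed_alcove:
  assumes z: "z \<in> sorted_cone m" "orb m w z n = z"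
    and x: "x \<in> sorted_cone m" "orb m w x (k * n) = x" "k \<ge> 1"
  shows "x \<in> closed_alcove m z"
proof -
  obtain a \<pi> where "tracks m w a \<pi> x" "tracks m w a \<pi> z"
    using tracks_exists[OF w co_ordered_periodic[OF x(2) z(2) x(3)]] by blast
  then interpret fixed_point_tracks m n w z a \<pi> using z by unfold_locales
  show ?thesis by (rule tracked_in_closed_alcove) fact+
qed

text \<open>A second fixed point lies in the closed alcove of the first, in its interior by its own
  genericity, and both have integral differences.\<close>

lemma fixed_point_unique:
  assumes z: "z \<in> sorted_cone m" "orb m w z n = z" and y: "y \<in> sorted_cone m" "orb m w y n = y"
  shows "y = z"
proof -
  obtain a \<pi> where "fixed_point_tracks m n w z a \<pi>" using fixed_point_tracks_exists[OF z] by blast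
  then interpret z: fixed_point_tracks m n w z a \<pi> .
  obtain b \<sigma> where "fixed_point_tracks m n w y b \<sigma>" using fixed_point_tracks_exists[OF y] by blast
  then interpret y: fixed_point_tracks m n w y b \<sigma> .
  have "y \<in> closed_alcove m z" by (rule periodic_in_closed_alcove[OF z y(1), of 1]) (use y in auto)
  then have "y \<in> open_alcove m z" using y.generic m by (rule closed_alcove_generic)
  then show ?thesis
    using z(1) by (intro integral_point_unique[OF m _ z.generic] z.diff_in_Ints y.diff_in_Ints)
      (auto simp: sorted_cone_def)
qed

lemma is_centroid_fixed_point:
  assumes z: "z \<in> sorted_cone m" "orb m w z n = z"
  shows "is_centroid m (closed_alcove m z) z"
proof -
  obtain a \<pi> where "fixed_point_tracks m n w z a \<pi>" using fixed_point_tracks_exists[OF z] by blast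
  then interpret fixed_point_tracks m n w z a \<pi> .
  have zz: "z \<in> zero_sum m" using z by (simp add: sorted_cone_def)
  have "x = z" if x: "x \<in> open_alcove m z" and i: "\<forall>i<m. (real m + 1) / 2 - x i \<in> \<int>" for x
  proof (rule integral_point_unique[OF m zz generic x diff_in_Ints])
    fix i j assume "i < m" "j < m"
    \<comment> \<open>Subtracting two centroid conditions leaves integral differences.\<close>
    then have "((real m + 1) / 2 - x j) - ((real m + 1) / 2 - x i) \<in> \<int>"
      using i by (blast intro: Ints_diff)
    then show "x i - x j \<in> \<int>" by simp
  qed
  then show ?thesis
    using centroid_in_Ints self_in_open_alcove[OF zz]
    by (simp add: is_centroid_def interior_closed_alcove Let_def)
qed

end

theorem theorem1p3:
  fixes m n :: nat and p :: "nat list" and xp :: "nat \<Rightarrow> real"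
  assumes "m > 0" and "n > 0" and "coprime m n"
    and "parking_function m n p"
    and "xp \<in> sorted_cone m" and "word_act m p xp = xp"
  shows "(\<forall>x\<in>sorted_cone m. word_act m p x = x \<longrightarrow> x = xp) \<and>
         (\<exists>A\<in>alcoves m.
            is_centroid m A xp \<and>
            periodic_points m p - {xp} = A - {xp} \<and>
            (\<forall>x\<in>A - {xp}. has_period m p m x))"
proof -
  define w where "w t = p ! (t mod n)" for t
  have len: "length p = n" and letters: "set p \<subseteq> {..<m}"
    using assms(4) by (auto simp: parking_function_def)
  have "w t < m" for t
  proof -
    have "w t \<in> set p" using len assms(2) by (simp add: w_def)
    then show ?thesis using letters by auto
  qed
  then interpret periodic_letters m n w
    using assms by unfold_locales (auto simp: w_def)
  have power: "word_act m (word_power p k) x = orb m w x (k * n)" for k x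
    using word_act_power[of m p k x] len by (simp add: w_def[abs_def])
  have once: "word_act m p x = orb m w x n" for x
    using power[of 1 x] by (simp add: word_power_def)
  have fixed: "orb m w xp n = xp" using assms(6) once by simp
  obtain a \<pi> where "fixed_point_tracks m n w xp a \<pi>"
    using fixed_point_tracks_exists[OF assms(5) fixed] by blast
  then interpret fixed_point_tracks m n w xp a \<pi> .
  have period: "has_period m p m x" if "x \<in> closed_alcove m xp" for x
    using return[OF that] m by (simp add: has_period_def power)
  \<comment> \<open>The fixed point counts as periodic here, so equality already holds before it is
    removed from both sides.\<close>
  have periodic: "periodic_points m p = closed_alcove m xp"
  proof
    show "periodic_points m p \<subseteq> closed_alcove m xp"
      using periodic_in_closed_alcove[OF z fixed]
      by (auto simp: periodic_points_def has_period_def power)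
    show "closed_alcove m xp \<subseteq> periodic_points m p"
      using closed_alcove_subset_sorted_cone[OF z generic] period
      unfolding periodic_points_def by blast
  qed
  have "x = xp" if "x \<in> sorted_cone m" "word_act m p x = x" for x
    using fixed_point_unique[OF z fixed that(1)] that(2) once by simp
  moreover have "closed_alcove m xp \<in> alcoves m"
    using z generic by (intro closed_alcove_in_alcoves) (auto simp: sorted_cone_def)
  moreover have "is_centroid m (closed_alcove m xp) xp"
    by (rule is_centroid_fixed_point[OF z fixed])
  ultimately show ?thesis using period periodic by blast
qed

end
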